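(* Let $(G_\alpha)_{\alpha\in I}$ be a family of countable groups, let $G=\prod_{\alpha\in I}G_\alpha$ be their direct product (in the restricted sense: all elements have only finitely many nonidentity coordinates), and let $H$ be a subgroup of $G$ such that $H\cap G'$ is supernormal in $H$ for every countable subproduct $G'$ of $G$. Then a subset $A\subset H$ is unconditionally closed in $H$ if and only if it is algebraic in $H$.
   Context: "Countable" means finite or countably infinite. Direct product: for a family of groups $(G_\alpha)_{\alpha\in I}$ (with $I$ an arbitrary index set), $\prod_{\alpha\in I}G_\alpha$ denotes the restricted direct product (direct sum), i.e., the group of all families $(g_\alpha)_{\alpha\in I}$ with $g_\alpha\in G_\alpha$ and $g_\alpha\ne 1_\alpha$ for only finitely many $\alpha$, with coordinatewise multiplication; $1_\alpha$ is the identity element of $G_\alpha$. Countable subproduct: a subgroup of $\prod_{\alpha\in I}G_\alpha$ of the form $\prod_{\alpha\in I}G'_\alpha$, where $G'_\alpha=G_\alpha$ for countably many indices $\alpha$ and $G'_\alpha=\{1_\alpha\}$ for the remaining $\alpha$. Supernormal: a subgroup $H'$ of a group $H$ is supernormal in $H$ if for every $x\in H$ there exists $y\in H'$ such that $x^{-1}hx=y^{-1}hy$ for all $h\in H'$. Unconditionally closed: a subset $A$ of a group $H$ is unconditionally closed in $H$ if it is closed in every Hausdorff group topology on $H$. Algebraic: a subset of a group $H$ with identity $1$ is elementary algebraic in $H$ if it has the form $\{x\in H: w(x)=1\}$ for some word $w=w(x)$ in the alphabet $H\cup\{x,x^{-1}\}$, where $x$ is a variable. A subset is additively algebraic in $H$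 if it is a finite (possibly empty) union of elementary algebraic sets. A subset is algebraic in $H$ if it is the intersection of an arbitrary family of additively algebraic sets. *)

theory Defs
  imports "HOL-Analysis.Analysis" "HOL-Algebra.Product_Groups"
begin

text \<open>
  A subgroup \<open>H\<close> of a group \<open>G\<close>, regarded as a group in its own right, is \<open>G\<lparr>carrier := H\<rparr>\<close>. The
  restricted direct product of \<open>G i\<close> for \<open>i \<in> I\<close> is \<open>sum_group I G\<close>; its elements are the finitely
  supported members of \<open>PiE I (\<lambda>i. carrier (G i))\<close>.
\<close>

definition countable_subproduct ::
    "'i set \<Rightarrow> ('i \<Rightarrow> ('a, 'b) monoid_scheme) \<Rightarrow> ('i \<Rightarrow> 'a) set \<Rightarrow> bool"
  where "countable_subproduct I G K \<longleftrightarrow>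
    (\<exists>J\<subseteq>I. countable J \<and>
      K = carrier (sum_group I G) \<inter> (\<Pi>\<^sub>E i\<in>I. if i \<in> J then carrier (G i) else {\<one>\<^bsub>G i\<^esub>}))"

definition supernormal :: "'a set \<Rightarrow> ('a, 'b) monoid_scheme \<Rightarrow> bool"
  where "supernormal N G \<longleftrightarrow>
    subgroup N G \<and>
    (\<forall>x\<in>carrier G. \<exists>y\<in>N. \<forall>h\<in>N.
      inv\<^bsub>G\<^esub> x \<otimes>\<^bsub>G\<^esub> h \<otimes>\<^bsub>G\<^esub> x = inv\<^bsub>G\<^esub> y \<otimes>\<^bsub>G\<^esub> h \<otimes>\<^bsub>G\<^esub> y)"

definition group_topology :: "('a, 'b) monoid_scheme \<Rightarrow> 'a topology \<Rightarrow> bool"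
  where "group_topology G T \<longleftrightarrow>
    topspace T = carrier G \<and>
    continuous_map (prod_topology T T) T (\<lambda>(x, y). x \<otimes>\<^bsub>G\<^esub> y) \<and>
    continuous_map T T (\<lambda>x. inv\<^bsub>G\<^esub> x)"

definition unconditionally_closed :: "('a, 'b) monoid_scheme \<Rightarrow> 'a set \<Rightarrow> bool"
  where "unconditionally_closed G A \<longleftrightarrow>
    (\<forall>T. group_topology G T \<and> Hausdorff_space T \<longrightarrow> closedin T A)"

datatype (constants: 'a) letter = Const 'a | Var | VarInv

fun eval_letter :: "('a, 'b) monoid_scheme \<Rightarrow> 'a \<Rightarrow> 'a letter \<Rightarrow> 'a"
  where
    "eval_letter G x (Const g) = g"
  | "eval_letter G x Var = x"
  | "eval_letter G x VarInv = inv\<^bsub>G\<^esub> x"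

definition eval_word :: "('a, 'b) monoid_scheme \<Rightarrow> 'a letter list \<Rightarrow> 'a \<Rightarrow> 'a"
  where "eval_word G w x = foldr (\<lambda>l v. eval_letter G x l \<otimes>\<^bsub>G\<^esub> v) w \<one>\<^bsub>G\<^esub>"

definition elementary_algebraic :: "('a, 'b) monoid_scheme \<Rightarrow> 'a set \<Rightarrow> bool"
  where "elementary_algebraic G A \<longleftrightarrow>
    (\<exists>w. (\<forall>l\<in>set w. constants l \<subseteq> carrier G) \<and>
      A = {x \<in> carrier G. eval_word G w x = \<one>\<^bsub>G\<^esub>})"

definition additively_algebraic :: "('a, 'b) monoid_scheme \<Rightarrow> 'a set \<Rightarrow> bool"
  where "additively_algebraic G A \<longleftrightarrow>
    (\<exists>F. finite F \<and> (\<forall>B\<in>F. elementary_algebraic G B) \<and> A = \<Union>F)"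

text \<open>Intersecting with the carrier only makes the intersection of the empty family the whole group.\<close>

definition algebraic_in :: "('a, 'b) monoid_scheme \<Rightarrow> 'a set \<Rightarrow> bool"
  where "algebraic_in G A \<longleftrightarrow>
    (\<exists>F. (\<forall>B\<in>F. additively_algebraic G B) \<and> A = carrier G \<inter> \<Inter>F)"

end

theory Submission
  imports Defs
begin

text \<open>
  Algebraic sets are always unconditionally closed, since words define continuous functions. For the
  converse, let \<open>A\<close> be unconditionally closed in \<open>H\<close>, and suppose that some \<open>x \<in> H - A\<close> lies in the
  Zariski closure of \<open>A\<close>: every finite set of equations that \<open>x\<close> does not solve is avoided by some
  element of \<open>A\<close>. The argument reduces to a countable group, where such an \<open>x\<close> can be made a limit of
  points of \<open>A\<close>.

  Reduction. For a countable set \<open>J\<close> of indices, let \<open>N\<close> be the intersection of \<open>H\<close> with the subproduct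
  over \<open>J\<close>; it is countable. It is supernormal in \<open>H\<close>, so every Hausdorff group topology on \<open>N\<close> extends
  to one on \<open>H\<close> in which \<open>N\<close> is open, and \<open>A \<inter> N\<close> is unconditionally closed in \<open>N\<close>
  (\<open>unconditionally_closed_Int_supernormal\<close>). On the other hand, \<open>J\<close> can be chosen by a closing-off
  argument (\<open>countable_closed_superset\<close>) so that \<open>x \<in> N\<close> and every finite set of equations over \<open>N\<close>
  not solved by \<open>x\<close> is avoided by an element of \<open>A \<inter> N\<close>: a finite set of words has constants with
  finite supports, and a countable group has only countably many finite sets of words. Then \<open>x\<close> is in
  the Zariski closure of \<open>A \<inter> N\<close> in \<open>N\<close>, so \<open>A \<inter> N\<close> is not algebraic in \<open>N\<close>.

  Countable groups. This contradicts Markov's theorem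
  (\<open>countable_unconditionally_closed_imp_algebraic\<close>). For its proof, one picks \<open>a\<^sub>0, a\<^sub>1, \<dots>\<close> in the set
  such that \<open>b\<^sub>m = x\<^sup>-\<^sup>1 a\<^sub>m\<close> tends to the identity in some Hausdorff group topology. Closing the
  tails of \<open>b\<close> under what a neighbourhood base requires yields sets \<open>U\<^sub>k\<close>; what has to be ensured is
  that each \<open>g \<noteq> 1\<close> is outside some \<open>U\<^sub>k\<close>. If only \<open>b\<^sub>0, \<dots>, b\<^sub>M\<close> are known, then \<open>U\<^sub>k\<close> consists of the values
  at \<open>a\<^sub>M\<close> of finitely many words (\<open>in_nbhd_insert_word_functions\<close>), and the choice \<open>a\<^sub>M = x\<close> would
  add nothing to \<open>U\<^sub>k\<close>. Hence keeping finitely many elements \<open>g\<close> out of their sets \<open>U\<^sub>k\<close> is a finite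
  system of inequations for \<open>a\<^sub>M\<close> that \<open>x\<close> satisfies, and so some element of the set does as well.
\<close>

section \<open>Group topologies from neighbourhoods of the identity\<close>

locale identity_neighbourhood_base = group G for G (structure) +
  fixes B :: "'a set set"
  assumes nonempty: "B \<noteq> {}"
    and subset: "U \<in> B \<Longrightarrow> U \<subseteq> carrier G"
    and one: "U \<in> B \<Longrightarrow> \<one> \<in> U"
    and int: "U \<in> B \<Longrightarrow> V \<in> B \<Longrightarrow> \<exists>W\<in>B. W \<subseteq> U \<inter> V"
    and mult: "U \<in> B \<Longrightarrow> \<exists>V\<in>B. \<forall>x\<in>V. \<forall>y\<in>V. x \<otimes> y \<in> U"
    and inv: "U \<in> B \<Longrightarrow> \<exists>V\<in>B. \<forall>x\<in>V. inv x \<in> U"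
    and conj: "U \<in> B \<Longrightarrow> g \<in> carrier G \<Longrightarrow> \<exists>V\<in>B. \<forall>x\<in>V. inv g \<otimes> x \<otimes> g \<in> U"
    and separated: "g \<in> carrier G \<Longrightarrow> g \<noteq> \<one> \<Longrightarrow> \<exists>U\<in>B. g \<notin> U"
begin

definition induced_topology :: "'a topology"
  where "induced_topology = topology (\<lambda>V. V \<subseteq> carrier G \<and> (\<forall>x\<in>V. \<exists>U\<in>B. \<forall>u\<in>U. x \<otimes> u \<in> V))"

lemma openin_induced_topology:
  "openin induced_topology V \<longleftrightarrow> V \<subseteq> carrier G \<and> (\<forall>x\<in>V. \<exists>U\<in>B. \<forall>u\<in>U. x \<otimes> u \<in> V)"
proof -
  let ?L = "\<lambda>V. V \<subseteq> carrier G \<and> (\<forall>x\<in>V. \<exists>U\<in>B. \<forall>u\<in>U. x \<otimes> u \<in> V)"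
  have "istopology ?L"
    unfolding istopology_def
  proof (intro conjI allI impI)
    fix S T assume S: "?L S" and T: "?L T"
    show "S \<inter> T \<subseteq> carrier G"
      using S by blast
    show "\<forall>x\<in>S \<inter> T. \<exists>U\<in>B. \<forall>u\<in>U. x \<otimes> u \<in> S \<inter> T"
    proof
      fix x assume "x \<in> S \<inter> T"
      then obtain U V where UV: "U \<in> B" "\<forall>u\<in>U. x \<otimes> u \<in> S" "V \<in> B" "\<forall>u\<in>V. x \<otimes> u \<in> T"
        using S T by blast
      with int obtain W where "W \<in> B" "W \<subseteq> U \<inter> V" by blast
      with UV show "\<exists>U\<in>B. \<forall>u\<in>U. x \<otimes> u \<in> S \<inter> T" by blast
    qed
  next
    fix K assume K: "\<forall>S\<in>K. ?L S"
    show "\<Union>K \<subseteq> carrier G"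
      using K by blast
    show "\<forall>x\<in>\<Union>K. \<exists>U\<in>B. \<forall>u\<in>U. x \<otimes> u \<in> \<Union>K"
      using K by (meson UnionE UnionI)
  qed
  then show ?thesis
    by (simp add: induced_topology_def)
qed

lemma topspace_induced_topology [simp]: "topspace induced_topology = carrier G"
proof
  show "topspace induced_topology \<subseteq> carrier G"
    using openin_induced_topology openin_topspace by blast
  have "openin induced_topology (carrier G)"
    using nonempty subset by (auto simp: openin_induced_topology) blast
  then show "carrier G \<subseteq> topspace induced_topology"
    by (rule openin_subset)
qed

text \<open>
  A translate \<open>x \<otimes> U\<close> need not itself be open; the open set inside it consists of the points
  around which some translated basic set stays in \<open>x \<otimes> U\<close>.
\<close>

lemma translate_contains_open:
  assumes U: "U \<in> B" and x: "x \<in> carrier G"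
  obtains V where "openin induced_topology V" "x \<in> V" "V \<subseteq> (\<lambda>u. x \<otimes> u) ` U"
proof
  let ?V = "{y \<in> carrier G. \<exists>W\<in>B. \<forall>w\<in>W. y \<otimes> w \<in> (\<lambda>u. x \<otimes> u) ` U}"
  show "x \<in> ?V"
    using U x by blast
  show "?V \<subseteq> (\<lambda>u. x \<otimes> u) ` U"
    using one r_one by fastforce
  show "openin induced_topology ?V"
    unfolding openin_induced_topology
  proof (intro conjI ballI)
    fix y assume "y \<in> ?V"
    then obtain W where y: "y \<in> carrier G" and W: "W \<in> B" "\<forall>w\<in>W. y \<otimes> w \<in> (\<lambda>u. x \<otimes> u) ` U"
      by blast
    obtain V where V: "V \<in> B" "\<forall>a\<in>V. \<forall>b\<in>V. a \<otimes> b \<in> W"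
      using mult W(1) by blast
    have "y \<otimes> v \<in> ?V" if v: "v \<in> V" for v
    proof -
      have "(y \<otimes> v) \<otimes> w \<in> (\<lambda>u. x \<otimes> u) ` U" if "w \<in> V" for w
        using that v V W y subset by (metis m_assoc subsetD)
      then show ?thesis
        using V(1) v y subset by blast
    qed
    with V(1) show "\<exists>U\<in>B. \<forall>u\<in>U. y \<otimes> u \<in> ?V" by blast
  qed blast
qed

lemma group_topology_induced_topology: "group_topology G induced_topology"
  unfolding group_topology_def
proof (intro conjI)
  show "continuous_map (prod_topology induced_topology induced_topology) induced_topology
          (\<lambda>(x, y). x \<otimes> y)"
    unfolding continuous_map
  proof (intro conjI allI impI)
    fix V assume V: "openin induced_topology V"
    let ?S = "{p \<in> topspace (prod_topology induced_topology induced_topology).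
        (case p of (x, y) \<Rightarrow> x \<otimes> y) \<in> V}"
    show "openin (prod_topology induced_topology induced_topology) ?S"
      unfolding openin_prod_topology_alt
    proof (intro allI impI)
      fix x y assume "(x, y) \<in> ?S"
      then have x: "x \<in> carrier G" and y: "y \<in> carrier G" and xy: "x \<otimes> y \<in> V"
        by auto
      obtain U where U: "U \<in> B" "\<forall>u\<in>U. (x \<otimes> y) \<otimes> u \<in> V"
        using V xy by (auto simp: openin_induced_topology)
      \<comment> \<open>\<open>(x \<otimes> a) \<otimes> (y \<otimes> b) = (x \<otimes> y) \<otimes> ((inv y \<otimes> a \<otimes> y) \<otimes> b)\<close>, so \<open>a\<close> must stay small after
        conjugation by \<open>y\<close>\<close>
      obtain U2 where U2: "U2 \<in> B" "\<forall>a\<in>U2. \<forall>b\<in>U2. a \<otimes> b \<in> U"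
        using mult U(1) by blast
      obtain U1 where U1: "U1 \<in> B" "\<forall>a\<in>U1. inv y \<otimes> a \<otimes> y \<in> U2"
        using conj U2(1) y by blast
      obtain P where P: "openin induced_topology P" "x \<in> P" "P \<subseteq> (\<lambda>u. x \<otimes> u) ` U1"
        using translate_contains_open U1(1) x by blast
      obtain Q where Q: "openin induced_topology Q" "y \<in> Q" "Q \<subseteq> (\<lambda>u. y \<otimes> u) ` U2"
        using translate_contains_open U2(1) y by blast
      have "p \<otimes> q \<in> V" if pq: "p \<in> P" "q \<in> Q" for p q
      proof -
        obtain a b where ab: "a \<in> U1" "p = x \<otimes> a" "b \<in> U2" "q = y \<otimes> b"
          using pq P(3) Q(3) by blast
        have c: "a \<in> carrier G" "b \<in> carrier G"
          using ab U1(1) U2(1) subset by auto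
        have "p \<otimes> q = (x \<otimes> y) \<otimes> ((inv y \<otimes> a \<otimes> y) \<otimes> b)"
          using ab c x y by (simp add: m_assoc[symmetric]) (simp add: m_assoc)
        then show ?thesis
          using ab U U1 U2 by auto
      qed
      moreover have "P \<subseteq> carrier G" "Q \<subseteq> carrier G"
        using P(1) Q(1) by (auto simp: openin_induced_topology)
      ultimately show "\<exists>P Q. openin induced_topology P \<and> openin induced_topology Q \<and>
          x \<in> P \<and> y \<in> Q \<and> P \<times> Q \<subseteq> ?S"
        using P Q by (intro exI[of _ P] exI[of _ Q] conjI) auto
    qed
  qed auto
  show "continuous_map induced_topology induced_topology (\<lambda>x. inv x)"
    unfolding continuous_map
  proof (intro conjI allI impI)
    fix V assume V: "openin induced_topology V"
    show "openin induced_topology {x \<in> topspace induced_topology. inv x \<in> V}"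
      unfolding openin_induced_topology
    proof (intro conjI ballI)
      fix x assume "x \<in> {x \<in> topspace induced_topology. inv x \<in> V}"
      then have x: "x \<in> carrier G" "inv x \<in> V" by auto
      obtain U where U: "U \<in> B" "\<forall>u\<in>U. inv x \<otimes> u \<in> V"
        using V x by (auto simp: openin_induced_topology)
      obtain U1 where U1: "U1 \<in> B" "\<forall>a\<in>U1. inv (inv x) \<otimes> a \<otimes> inv x \<in> U"
        using conj U(1) x by (meson inv_closed)
      obtain U2 where U2: "U2 \<in> B" "\<forall>a\<in>U2. inv a \<in> U1"
        using inv U1(1) by blast
      have "inv (x \<otimes> u) \<in> V" if u: "u \<in> U2" for u
      proof -
        have c: "u \<in> carrier G" using u U2(1) subset by auto
        have "inv (x \<otimes> u) = inv x \<otimes> (inv (inv x) \<otimes> inv u \<otimes> inv x)"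
          using x c by (simp add: inv_mult_group m_assoc[symmetric])
        then show ?thesis using u U U1 U2 by auto
      qed
      then show "\<exists>U\<in>B. \<forall>u\<in>U. x \<otimes> u \<in> {x \<in> topspace induced_topology. inv x \<in> V}"
        using U2(1) x subset by (intro bexI[of _ U2]) auto
    qed auto
  qed auto
qed simp

lemma Hausdorff_space_induced_topology: "Hausdorff_space induced_topology"
  unfolding Hausdorff_space_def
proof (intro allI impI, clarsimp)
  fix x y assume x: "x \<in> carrier G" and y: "y \<in> carrier G" and xy: "x \<noteq> y"
  have "inv x \<otimes> y \<noteq> \<one>"
    using x y xy by (metis inv_closed inv_equality inv_inv)
  then obtain U where U: "U \<in> B" "inv x \<otimes> y \<notin> U"
    using separated x y by blast
  obtain V where V: "V \<in> B" "\<forall>a\<in>V. \<forall>b\<in>V. a \<otimes> b \<in> U"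
    using mult U(1) by blast
  obtain W where W: "W \<in> B" "\<forall>a\<in>W. inv a \<in> V"
    using inv V(1) by blast
  obtain P where P: "openin induced_topology P" "x \<in> P" "P \<subseteq> (\<lambda>u. x \<otimes> u) ` V"
    using translate_contains_open V(1) x by blast
  obtain Q where Q: "openin induced_topology Q" "y \<in> Q" "Q \<subseteq> (\<lambda>u. y \<otimes> u) ` W"
    using translate_contains_open W(1) y by blast
  have "disjnt P Q"
    unfolding disjnt_iff
  proof (intro allI notI, elim conjE)
    fix z assume "z \<in> P" "z \<in> Q"
    then obtain v w where vw: "v \<in> V" "z = x \<otimes> v" "w \<in> W" "z = y \<otimes> w"
      using P(3) Q(3) by blast
    have c: "v \<in> carrier G" "w \<in> carrier G"
      using vw V(1) W(1) subset by auto
    have "y = x \<otimes> v \<otimes> inv w"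
      using vw c x y by (metis inv_solve_right m_closed)
    then have "inv x \<otimes> y = v \<otimes> inv w"
      using c x by (simp add: m_assoc[symmetric])
    then show False
      using U V W vw by auto
  qed
  with P Q show "\<exists>P. openin induced_topology P \<and> (\<exists>Q. openin induced_topology Q \<and>
      x \<in> P \<and> y \<in> Q \<and> disjnt P Q)" by blast
qed

lemma unconditionally_closed_avoids_translate:
  assumes "unconditionally_closed G A" "x \<in> carrier G - A"
  obtains U where "U \<in> B" "\<forall>u\<in>U. x \<otimes> u \<notin> A"
proof -
  have "closedin induced_topology A"
    using assms(1) group_topology_induced_topology Hausdorff_space_induced_topology
    by (simp add: unconditionally_closed_def)
  then have "openin induced_topology (carrier G - A)"
    by (simp add: closedin_def)
  then show ?thesis
    using assms(2) that by (fastforce simp: openin_induced_topology)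
qed

end

section \<open>Algebraic sets and their closedness\<close>

lemma continuous_map_group_mult:
  assumes "group_topology G T" "continuous_map S T f" "continuous_map S T g"
  shows "continuous_map S T (\<lambda>x. f x \<otimes>\<^bsub>G\<^esub> g x)"
proof -
  have "continuous_map S T ((\<lambda>(x, y). x \<otimes>\<^bsub>G\<^esub> y) \<circ> (\<lambda>x. (f x, g x)))"
    by (rule continuous_map_compose[where X' = "prod_topology T T"])
      (use assms in \<open>auto simp: group_topology_def continuous_map_paired\<close>)
  then show ?thesis by (simp add: o_def)
qed

lemma continuous_map_eval_word:
  assumes "group G" and T: "group_topology G T" and "\<forall>l\<in>set w. constants l \<subseteq> carrier G"
  shows "continuous_map T T (eval_word G w)"
  using assms(3)
proof (induction w)
  case Nil
  then show ?case
    using assms(1) T by (simp add: eval_word_def group_topology_def group.is_monoid)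
next
  case (Cons l w)
  have "continuous_map T T (\<lambda>x. eval_letter G x l)"
    using T Cons.prems by (cases l) (auto simp: group_topology_def)
  with Cons continuous_map_group_mult[OF T] show ?case
    by (simp add: eval_word_def)
qed

text \<open>
  The easy direction: words are continuous for every group topology, and Hausdorffness makes the
  identity a closed point, so solution sets of equations are closed.
\<close>

lemma algebraic_imp_unconditionally_closed:
  assumes "group G" "algebraic_in G A"
  shows "unconditionally_closed G A"
  unfolding unconditionally_closed_def
proof (intro allI impI, elim conjE)
  fix T assume T: "group_topology G T" "Hausdorff_space T"
  have top: "topspace T = carrier G"
    using T by (simp add: group_topology_def)
  have "closedin T {\<one>\<^bsub>G\<^esub>}"
    using T(2) top \<open>group G\<close>
    by (simp add: closedin_Hausdorff_sing_eq group.is_monoid)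
  then have "closedin T B" if "elementary_algebraic G B" for B
    using that closedin_continuous_map_preimage continuous_map_eval_word[OF assms(1) T(1)] top
    by (fastforce simp: elementary_algebraic_def)
  then have add: "closedin T B" if "additively_algebraic G B" for B
    using that unfolding additively_algebraic_def by (metis closedin_Union)
  obtain F where F: "\<forall>B\<in>F. additively_algebraic G B" "A = carrier G \<inter> \<Inter>F"
    using assms(2) by (auto simp: algebraic_in_def)
  have "closedin T (\<Inter>(insert (carrier G) F))"
    using F(1) add top closedin_topspace[of T] by (intro closedin_Inter) auto
  then show "closedin T A" by (simp add: F(2))
qed

text \<open>
  Read contrapositively: \<open>A\<close> fails to be algebraic exactly when some \<open>x \<notin> A\<close> cannot be separated from
  \<open>A\<close> by finitely many words, that is, when \<open>x\<close> lies in the Zariski closure of \<open>A\<close>. Both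
  constructions below consume this one finite condition at a time.
\<close>

lemma algebraic_in_iff_separated:
  assumes "A \<subseteq> carrier G"
  shows "algebraic_in G A \<longleftrightarrow>
    (\<forall>x\<in>carrier G - A. \<exists>F. finite F \<and> (\<forall>B\<in>F. elementary_algebraic G B \<and> x \<notin> B) \<and> A \<subseteq> \<Union>F)"
    (is "?L \<longleftrightarrow> ?R")
proof
  assume ?L
  then obtain F where F: "\<forall>B\<in>F. additively_algebraic G B" "A = carrier G \<inter> \<Inter>F"
    by (auto simp: algebraic_in_def)
  show ?R
  proof
    fix x assume "x \<in> carrier G - A"
    then obtain B where B: "B \<in> F" "x \<notin> B" using F by blast
    then obtain E where "finite E" "\<forall>C\<in>E. elementary_algebraic G C" "B = \<Union>E"
      using F by (auto simp: additively_algebraic_def)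
    with B F show "\<exists>F. finite F \<and> (\<forall>B\<in>F. elementary_algebraic G B \<and> x \<notin> B) \<and> A \<subseteq> \<Union>F"
      by (intro exI[of _ E]) auto
  qed
next
  assume R: ?R
  have eq: "A = carrier G \<inter> \<Inter>{B. additively_algebraic G B \<and> A \<subseteq> B}"
  proof
    show "A \<subseteq> carrier G \<inter> \<Inter>{B. additively_algebraic G B \<and> A \<subseteq> B}"
      using assms by blast
    show "carrier G \<inter> \<Inter>{B. additively_algebraic G B \<and> A \<subseteq> B} \<subseteq> A"
    proof (rule subsetI, rule ccontr)
      fix x assume x: "x \<in> carrier G \<inter> \<Inter>{B. additively_algebraic G B \<and> A \<subseteq> B}" "x \<notin> A"
      then have "x \<in> carrier G - A" by simp
      from bspec[OF R this]
      obtain F where F: "finite F" "\<forall>B\<in>F. elementary_algebraic G B \<and> x \<notin> B" "A \<subseteq> \<Union>F"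
        by (elim exE conjE)
      then have "additively_algebraic G (\<Union>F)"
        by (auto simp: additively_algebraic_def)
      with F(3) have "x \<in> \<Union>F"
        using x(1) by blast
      with F(2) show False by simp
    qed
  qed
  show ?L
    unfolding algebraic_in_def by (rule exI, rule conjI[OF _ eq], simp)
qed

section \<open>Supernormal subgroups\<close>

text \<open>
  A Hausdorff group topology on \<open>N\<close> extends to \<open>H\<close>: its neighbourhoods of the identity are also a
  base at the identity of \<open>H\<close>, making \<open>N\<close> an open subgroup with its given topology. Invariance under
  conjugation by an arbitrary \<open>g \<in> H\<close> is the one condition that the topology on \<open>N\<close> does not provide;
  supernormality gives it, since conjugation by \<open>g\<close> acts on \<open>N\<close> as conjugation by some \<open>y \<in> N\<close>, which is continuous.
\<close>

lemma unconditionally_closed_Int_supernormal: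
  assumes "group H" and N: "supernormal N H" and A: "A \<subseteq> carrier H" "unconditionally_closed H A"
  shows "unconditionally_closed (H\<lparr>carrier := N\<rparr>) (A \<inter> N)"
  unfolding unconditionally_closed_def
proof (intro allI impI, elim conjE)
  interpret H: group H by fact
  have sub: "subgroup N H"
    using N by (simp add: supernormal_def)
  have conj: "\<exists>y\<in>N. \<forall>h\<in>N. inv\<^bsub>H\<^esub> x \<otimes>\<^bsub>H\<^esub> h \<otimes>\<^bsub>H\<^esub> x = inv\<^bsub>H\<^esub> y \<otimes>\<^bsub>H\<^esub> h \<otimes>\<^bsub>H\<^esub> y"
    if "x \<in> carrier H" for x
    using N that by (auto simp: supernormal_def)
  interpret N: subgroup N H by fact
  fix T assume T: "group_topology (H\<lparr>carrier := N\<rparr>) T" and Haus: "Hausdorff_space T"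
  have top: "topspace T = N"
    using T by (simp add: group_topology_def)
  have multc: "continuous_map (prod_topology T T) T (\<lambda>(x, y). x \<otimes>\<^bsub>H\<^esub> y)"
    using T by (simp add: group_topology_def)
  have "continuous_map T T (\<lambda>x. inv\<^bsub>H\<lparr>carrier := N\<rparr>\<^esub> x)"
    using T by (simp add: group_topology_def)
  then have invc: "continuous_map T T (\<lambda>x. inv\<^bsub>H\<^esub> x)"
    by (rule continuous_map_eq) (simp add: top sub)
  note mult_cont = continuous_map_group_mult[OF T, simplified]
  have open_pre: "openin T {x \<in> N. f x \<in> U}" if "openin T U" "continuous_map T T f" for f U
    using that top openin_continuous_map_preimage by fastforce
  have const: "continuous_map T T (\<lambda>x. c)" if "c \<in> N" for c
    using that top by simp
  let ?B = "{U. openin T U \<and> \<one>\<^bsub>H\<^esub> \<in> U}"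
  have subN: "U \<subseteq> N" if "openin T U" for U
    using that top openin_subset by blast
  interpret base: identity_neighbourhood_base H ?B
  proof
    show "?B \<noteq> {}"
      using openin_topspace[of T] top by (auto intro!: exI[of _ N])
    show "U \<subseteq> carrier H" if "U \<in> ?B" for U
      using that subN N.subset by blast
    show "\<one>\<^bsub>H\<^esub> \<in> U" if "U \<in> ?B" for U
      using that by blast
    show "\<exists>W\<in>?B. W \<subseteq> U \<inter> V" if "U \<in> ?B" "V \<in> ?B" for U V
      using that by (intro bexI[of _ "U \<inter> V"]) auto
    show "\<exists>V\<in>?B. \<forall>x\<in>V. \<forall>y\<in>V. x \<otimes>\<^bsub>H\<^esub> y \<in> U" if U: "U \<in> ?B" for U
    proof -
      define P where
        "P = {p \<in> topspace (prod_topology T T). (case p of (x, y) \<Rightarrow> x \<otimes>\<^bsub>H\<^esub> y) \<in> U}"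
      have openP: "openin (prod_topology T T) P"
        using U multc openin_continuous_map_preimage unfolding P_def by blast
      have oneP: "(\<one>\<^bsub>H\<^esub>, \<one>\<^bsub>H\<^esub>) \<in> P"
        using U top by (simp add: P_def)
      obtain V W where VW: "openin T V" "openin T W" "\<one>\<^bsub>H\<^esub> \<in> V" "\<one>\<^bsub>H\<^esub> \<in> W" "V \<times> W \<subseteq> P"
        using iffD1[OF openin_prod_topology_alt openP, rule_format, OF oneP] by auto
      have "x \<otimes>\<^bsub>H\<^esub> y \<in> U" if "x \<in> V \<inter> W" "y \<in> V \<inter> W" for x y
        using that VW(5) by (auto simp: P_def)
      with VW show ?thesis
        by (intro bexI[of _ "V \<inter> W"]) auto
    qed
    show "\<exists>V\<in>?B. \<forall>x\<in>V. inv\<^bsub>H\<^esub> x \<in> U" if "U \<in> ?B" for U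
      using that open_pre[OF _ invc, of U] by (intro bexI[of _ "{x \<in> N. inv\<^bsub>H\<^esub> x \<in> U}"]) auto
    show "\<exists>V\<in>?B. \<forall>x\<in>V. inv\<^bsub>H\<^esub> g \<otimes>\<^bsub>H\<^esub> x \<otimes>\<^bsub>H\<^esub> g \<in> U" if U: "U \<in> ?B" and g: "g \<in> carrier H" for U g
    proof -
      obtain y where y: "y \<in> N"
        "\<forall>h\<in>N. inv\<^bsub>H\<^esub> g \<otimes>\<^bsub>H\<^esub> h \<otimes>\<^bsub>H\<^esub> g = inv\<^bsub>H\<^esub> y \<otimes>\<^bsub>H\<^esub> h \<otimes>\<^bsub>H\<^esub> y"
        using conj g by blast
      have "continuous_map T T (\<lambda>x. inv\<^bsub>H\<^esub> y \<otimes>\<^bsub>H\<^esub> x \<otimes>\<^bsub>H\<^esub> y)"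
        using y(1) by (intro mult_cont const) auto
      then have "openin T {x \<in> N. inv\<^bsub>H\<^esub> y \<otimes>\<^bsub>H\<^esub> x \<otimes>\<^bsub>H\<^esub> y \<in> U}"
        using U open_pre by blast
      then show ?thesis
        using U y by (intro bexI[of _ "{x \<in> N. inv\<^bsub>H\<^esub> y \<otimes>\<^bsub>H\<^esub> x \<otimes>\<^bsub>H\<^esub> y \<in> U}"]) auto
    qed
    show "\<exists>U\<in>?B. g \<notin> U" if g: "g \<in> carrier H" "g \<noteq> \<one>\<^bsub>H\<^esub>" for g
    proof (cases "g \<in> N")
      case True
      then show ?thesis
        using Haus g(2) top unfolding Hausdorff_space_def disjnt_iff
        by (metis (mono_tags, lifting) N.one_closed mem_Collect_eq)
    next
      case False
      then show ?thesis
        using openin_topspace[of T] top by (auto intro!: exI[of _ N])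
    qed
  qed
  \<comment> \<open>In the extended topology some translate \<open>x \<otimes> U\<close> of an open \<open>U \<subseteq> N\<close> misses \<open>A\<close>; that translate is
    already open in \<open>T\<close>.\<close>
  have "openin T (N - A)"
  proof (subst openin_subopen, intro ballI)
    fix x assume x: "x \<in> N - A"
    then obtain U where U: "U \<in> ?B" "\<forall>u\<in>U. x \<otimes>\<^bsub>H\<^esub> u \<notin> A"
      using base.unconditionally_closed_avoids_translate[OF A(2), of x] N.subset by blast
    let ?V = "{y \<in> N. inv\<^bsub>H\<^esub> x \<otimes>\<^bsub>H\<^esub> y \<in> U}"
    have "continuous_map T T (\<lambda>y. inv\<^bsub>H\<^esub> x \<otimes>\<^bsub>H\<^esub> y)"
      using x by (intro mult_cont const) auto
    then have "openin T ?V"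
      using U open_pre by blast
    moreover have "x \<in> ?V"
      using x U by simp
    moreover have "?V \<subseteq> N - A"
    proof
      fix y assume y: "y \<in> ?V"
      then have "x \<otimes>\<^bsub>H\<^esub> (inv\<^bsub>H\<^esub> x \<otimes>\<^bsub>H\<^esub> y) = y"
        using x by (simp add: H.m_assoc[symmetric])
      then show "y \<in> N - A"
        using U y by force
    qed
    ultimately show "\<exists>V. openin T V \<and> x \<in> V \<and> V \<subseteq> N - A" by blast
  qed
  then show "closedin T (A \<inter> N)"
    by (simp add: closedin_def top Diff_Int2 Int_commute Diff_Int)
qed

section \<open>Functions given by words\<close>

definition word_function :: "('a, 'b) monoid_scheme \<Rightarrow> ('a \<Rightarrow> 'a) \<Rightarrow> bool"
  where "word_function G f \<longleftrightarrow>
    (\<exists>w. (\<forall>l\<in>set w. constants l \<subseteq> carrier G) \<and> (\<forall>x\<in>carrier G. f x = eval_word G w x))"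

context group
begin

lemma eval_letter_closed:
  assumes "constants l \<subseteq> carrier G" "x \<in> carrier G"
  shows "eval_letter G x l \<in> carrier G"
  using assms by (cases l) auto

lemma eval_word_closed:
  assumes "\<forall>l\<in>set w. constants l \<subseteq> carrier G" "x \<in> carrier G"
  shows "eval_word G w x \<in> carrier G"
  using assms by (induction w) (auto simp: eval_word_def eval_letter_closed)

lemma eval_word_append:
  assumes "\<forall>l\<in>set v. constants l \<subseteq> carrier G" "\<forall>l\<in>set w. constants l \<subseteq> carrier G" "x \<in> carrier G"
  shows "eval_word G (v @ w) x = eval_word G v x \<otimes> eval_word G w x"
  using assms(1)
proof (induction v)
  case Nil
  then show ?case
    using assms eval_word_closed[of w x] by (simp add: eval_word_def)
next
  case (Cons l v)
  have "eval_letter G x l \<in> carrier G" "eval_word G v x \<in> carrier G" "eval_word G w x \<in> carrier G"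
    using Cons.prems assms by (auto simp: eval_word_closed eval_letter_closed)
  with Cons show ?case
    by (simp add: eval_word_def m_assoc)
qed

lemma word_function_const: "c \<in> carrier G \<Longrightarrow> word_function G (\<lambda>_. c)"
  unfolding word_function_def by (rule exI[of _ "[Const c]"]) (simp add: eval_word_def)

lemma word_function_ident: "word_function G (\<lambda>x. x)"
  unfolding word_function_def by (rule exI[of _ "[Var]"]) (simp add: eval_word_def)

lemma word_function_inv: "word_function G (\<lambda>x. inv x)"
  unfolding word_function_def by (rule exI[of _ "[VarInv]"]) (simp add: eval_word_def)

lemma word_function_mult:
  assumes "word_function G f" "word_function G g"
  shows "word_function G (\<lambda>x. f x \<otimes> g x)"
proof -
  obtain v w where
    "\<forall>l\<in>set v. constants l \<subseteq> carrier G" "\<forall>x\<in>carrier G. f x = eval_word G v x"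
    "\<forall>l\<in>set w. constants l \<subseteq> carrier G" "\<forall>x\<in>carrier G. g x = eval_word G w x"
    using assms unfolding word_function_def by blast
  then show ?thesis
    unfolding word_function_def by (intro exI[of _ "v @ w"]) (auto simp: eval_word_append)
qed

lemma elementary_algebraic_word_function_eq:
  assumes "word_function G f" "c \<in> carrier G"
  shows "elementary_algebraic G {x \<in> carrier G. f x = c}"
proof -
  have "word_function G (\<lambda>x. f x \<otimes> inv c)"
    using assms by (intro word_function_mult word_function_const) auto
  then obtain w where w: "\<forall>l\<in>set w. constants l \<subseteq> carrier G"
    "\<forall>x\<in>carrier G. f x \<otimes> inv c = eval_word G w x"
    unfolding word_function_def by blast
  have "f x \<in> carrier G" if "x \<in> carrier G" for x
    using assms(1) that eval_word_closed by (auto simp: word_function_def)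
  then have "f x = c \<longleftrightarrow> f x \<otimes> inv c = \<one>" if "x \<in> carrier G" for x
    using that assms(2) by (metis inv_equality inv_inv inv_closed r_inv)
  with w show ?thesis
    unfolding elementary_algebraic_def by (intro exI[of _ w]) auto
qed

end

section \<open>Neighbourhoods generated by a sequence\<close>

text \<open>
  The \<open>k\<close>-th basic neighbourhood of the identity in a group topology in which a prescribed sequence
  \<open>b\<close> tends to the identity; \<open>S\<close> is the graph of \<open>b\<close>, or of an initial piece of it, and \<open>e\<close> enumerates
  the group. The rules close these sets under exactly what a base at the identity must satisfy:
  the \<open>k\<close>-th set contains the tail of the sequence from \<open>k\<close> on, products of two elements of the next
  set, and conjugates by \<open>e i\<close> of elements of the set that lies \<open>i + 1\<close> levels further on. Products and
  conjugates come from strictly higher levels, and a generator of index \<open>m\<close> is available up to level \<open>m\<close>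
  only, so finitely many generators produce finitely many elements at each level.
\<close>

inductive in_nbhd :: "('a, 'b) monoid_scheme \<Rightarrow> (nat \<Rightarrow> 'a) \<Rightarrow> (nat \<times> 'a) set \<Rightarrow> nat \<Rightarrow> 'a \<Rightarrow> bool"
  for G (structure) and e S
  where
    one: "in_nbhd G e S k \<one>"
  | gen: "(m, b) \<in> S \<Longrightarrow> k \<le> m \<Longrightarrow> in_nbhd G e S k b"
  | gen_inv: "(m, b) \<in> S \<Longrightarrow> k \<le> m \<Longrightarrow> in_nbhd G e S k (inv b)"
  | mult: "in_nbhd G e S (Suc k) x \<Longrightarrow> in_nbhd G e S (Suc k) y \<Longrightarrow> in_nbhd G e S k (x \<otimes> y)"
  | conj: "in_nbhd G e S (Suc (k + i)) x \<Longrightarrow> in_nbhd G e S k (inv (e i) \<otimes> x \<otimes> e i)"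

lemma in_nbhd_directed_Union:
  assumes "in_nbhd G e (\<Union>n. S n) k x" and mono: "\<And>m n::nat. m \<le> n \<Longrightarrow> S m \<subseteq> S n"
  shows "\<exists>n. in_nbhd G e (S n) k x"
proof -
  have lift: "in_nbhd G e (S n) k x" if "in_nbhd G e (S m) k x" "m \<le> n" for m n k x
    using that(1) mono[OF that(2)] by (induction rule: in_nbhd.induct) (auto intro: in_nbhd.intros)
  show ?thesis
    using assms(1)
  proof (induction rule: in_nbhd.induct)
    case (mult k x y)
    then obtain m n where "in_nbhd G e (S m) (Suc k) x" "in_nbhd G e (S n) (Suc k) y" by blast
    then have "in_nbhd G e (S (max m n)) (Suc k) x" "in_nbhd G e (S (max m n)) (Suc k) y"
      using lift max.cobounded1 max.cobounded2 by blast+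
    then show ?case
      by (blast intro: in_nbhd.mult)
  qed (blast intro: in_nbhd.intros)+
qed

context group
begin

lemma in_nbhd_closed:
  assumes "in_nbhd G e S k x" "range e \<subseteq> carrier G" "S \<subseteq> UNIV \<times> carrier G"
  shows "x \<in> carrier G"
  using assms by (induction rule: in_nbhd.induct) (auto simp: image_subset_iff)

lemma in_nbhd_antimono:
  assumes "in_nbhd G e S l x" "k \<le> l" "range e \<subseteq> carrier G" "S \<subseteq> UNIV \<times> carrier G"
  shows "in_nbhd G e S k x"
  using assms(2,1)
proof (induction k rule: inc_induct)
  case (step k)
  then have "in_nbhd G e S k (x \<otimes> \<one>)"
    by (intro in_nbhd.mult in_nbhd.one) auto
  then show ?case
    using in_nbhd_closed[OF assms(1,3,4)] by simp
qed

lemma in_nbhd_inv: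
  assumes "in_nbhd G e S k x" "range e \<subseteq> carrier G" "S \<subseteq> UNIV \<times> carrier G"
  shows "in_nbhd G e S k (inv x)"
  using assms(1)
proof (induction rule: in_nbhd.induct)
  case (mult k x y)
  have "x \<in> carrier G" "y \<in> carrier G"
    using mult in_nbhd_closed assms(2,3) by blast+
  with mult show ?case
    by (simp add: inv_mult_group in_nbhd.mult)
next
  case (conj k i x)
  have "x \<in> carrier G" "e i \<in> carrier G"
    using conj in_nbhd_closed assms(2,3) by blast+
  then have "inv (inv (e i) \<otimes> x \<otimes> e i) = inv (e i) \<otimes> inv x \<otimes> e i"
    by (simp add: inv_mult_group m_assoc)
  with conj show ?case
    by (simp add: in_nbhd.conj)
next
  case (gen_inv m b k)
  then have "inv (inv b) = b"
    using assms(3) by auto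
  with gen_inv show ?case
    by (simp add: in_nbhd.gen)
qed (use assms in \<open>auto intro: in_nbhd.intros\<close>)

lemma in_nbhd_beyond_indices:
  assumes "in_nbhd G e S k x" "\<forall>(m, b)\<in>S. m < k" "range e \<subseteq> carrier G"
  shows "x = \<one>"
  using assms(1,2)
proof (induction rule: in_nbhd.induct)
  case (mult k x y)
  then have "x = \<one>" "y = \<one>" by fastforce+
  then show ?case by simp
next
  case (conj k i x)
  then have "x = \<one>" by fastforce
  moreover have "e i \<in> carrier G" using assms(3) by auto
  ultimately show ?case by simp
qed auto

text \<open>
  The finiteness behind the choice of the sequence. Consider the next generator \<open>inv x \<otimes> t\<close>, of index
  \<open>M\<close>, as depending on an unknown \<open>t\<close>. The elements at level \<open>k\<close> are then values at \<open>t\<close> of finitely many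
  words that do not depend on \<open>t\<close>. At \<open>t = x\<close> the new generator is the identity, so these words take
  values that were already present at level \<open>k\<close>. The words are built by recursion from level \<open>M + 1\<close>, where
  only the identity occurs, downwards.
\<close>

lemma in_nbhd_insert_word_functions:
  assumes S: "finite S" "S \<subseteq> {..<M} \<times> carrier G" and e: "range e \<subseteq> carrier G" and x: "x \<in> carrier G"
  shows "\<exists>F. finite F \<and> (\<forall>f\<in>F. word_function G f \<and> in_nbhd G e S k (f x)) \<and>
    (\<forall>t\<in>carrier G. \<forall>y. in_nbhd G e (insert (M, inv x \<otimes> t) S) k y \<longrightarrow> (\<exists>f\<in>F. y = f t))"
proof (induction "Suc M - k" arbitrary: k rule: less_induct)
  case less
  let ?ok = "\<lambda>k F. finite F \<and> (\<forall>f\<in>F. word_function G f \<and> in_nbhd G e S k (f x)) \<and>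
    (\<forall>t\<in>carrier G. \<forall>y. in_nbhd G e (insert (M, inv x \<otimes> t) S) k y \<longrightarrow> (\<exists>f\<in>F. y = f t))"
  have late: "y = \<one>" if "in_nbhd G e (insert (M, inv x \<otimes> t) S) j y" "M < j" for t j y
    using in_nbhd_beyond_indices[OF that(1) _ e] S(2) that(2) by fastforce
  show ?case
  proof (cases "M < k")
    case True
    then have "?ok k {\<lambda>_. \<one>}"
      using late by (auto intro: in_nbhd.one word_function_const)
    then show ?thesis by blast
  next
    case False
    then have "\<exists>F. ?ok j F" if "k < j" for j
    proof -
      have "Suc M - j < Suc M - k"
        using False that by linarith
      then show ?thesis by (rule less.hyps)
    qed
    then obtain F where F: "\<And>j. k < j \<Longrightarrow> ?ok j (F j)"
      by metis
    have cover: "\<exists>f\<in>F j. y = f t"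
      if "k < j" "t \<in> carrier G" "in_nbhd G e (insert (M, inv x \<otimes> t) S) j y" for j t y
      using F[OF that(1)] that(2,3) by simp
    \<comment> \<open>One set for each rule. Conjugation by \<open>e i\<close> with \<open>i > M\<close> uses a level beyond \<open>M\<close>, so it yields only
      the identity and a finite union suffices.\<close>
    define E where "E = {\<lambda>_. \<one>, \<lambda>t. inv x \<otimes> t, \<lambda>t. inv t \<otimes> x}
      \<union> (\<lambda>(m, b) _. b) ` {p \<in> S. k \<le> fst p} \<union> (\<lambda>(m, b) _. inv b) ` {p \<in> S. k \<le> fst p}
      \<union> (\<lambda>(f, g) t. f t \<otimes> g t) ` (F (Suc k) \<times> F (Suc k))
      \<union> (\<Union>i\<le>M. (\<lambda>f t. inv (e i) \<otimes> f t \<otimes> e i) ` F (Suc (k + i)))"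
    have base: "(\<lambda>_. \<one>) \<in> E" "(\<lambda>t. inv x \<otimes> t) \<in> E" "(\<lambda>t. inv t \<otimes> x) \<in> E"
      by (simp_all add: E_def)
    have ei: "e i \<in> carrier G" for i
      using e by auto
    have bS: "b \<in> carrier G" if "(m, b) \<in> S" for m b
      using S(2) that by auto
    have finE: "finite E"
      unfolding E_def using S(1) F by auto
    have wordE: "word_function G f \<and> in_nbhd G e S k (f x)" if "f \<in> E" for f
      using that unfolding E_def
    proof (elim UnE)
      assume "f \<in> {\<lambda>_. \<one>, \<lambda>t. inv x \<otimes> t, \<lambda>t. inv t \<otimes> x}"
      then show ?thesis
        using x by (auto intro!: word_function_mult word_function_const word_function_ident
            word_function_inv in_nbhd.one)
    next
      assume "f \<in> (\<lambda>(m, b) _. b) ` {p \<in> S. k \<le> fst p}"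
      then show ?thesis
        using bS by (auto intro: word_function_const in_nbhd.gen)
    next
      assume "f \<in> (\<lambda>(m, b) _. inv b) ` {p \<in> S. k \<le> fst p}"
      then show ?thesis
        using bS by (auto intro: word_function_const in_nbhd.gen_inv)
    next
      assume "f \<in> (\<lambda>(f, g) t. f t \<otimes> g t) ` (F (Suc k) \<times> F (Suc k))"
      then show ?thesis
        using F[of "Suc k"] by (auto intro: word_function_mult in_nbhd.mult)
    next
      assume "f \<in> (\<Union>i\<le>M. (\<lambda>f t. inv (e i) \<otimes> f t \<otimes> e i) ` F (Suc (k + i)))"
      then obtain i g where "g \<in> F (Suc (k + i))" "f = (\<lambda>t. inv (e i) \<otimes> g t \<otimes> e i)"
        by blast
      then show ?thesis
        using F[of "Suc (k + i)"] ei
        by (auto intro!: word_function_mult word_function_const in_nbhd.conj)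
    qed
    have coverE: "\<exists>f\<in>E. y = f t"
      if t: "t \<in> carrier G" and y: "in_nbhd G e (insert (M, inv x \<otimes> t) S) k y" for t y
      using y
    proof cases
      case one
      then show ?thesis by (rule bexI[OF _ base(1)])
    next
      case (gen m)
      show ?thesis
      proof (cases "(m, y) \<in> S")
        case True
        then have "(\<lambda>_. y) \<in> E"
          unfolding E_def using gen(2) by force
        then show ?thesis by (rule rev_bexI) simp
      next
        case False
        then have "y = inv x \<otimes> t" using gen by simp
        then show ?thesis by (rule bexI[OF _ base(2)])
      qed
    next
      case (gen_inv m b)
      show ?thesis
      proof (cases "(m, b) \<in> S")
        case True
        then have "(\<lambda>_. y) \<in> E"
          unfolding E_def using gen_inv by force
        then show ?thesis by (rule rev_bexI) simp
      next
        case False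
        then have "y = inv t \<otimes> x"
          using gen_inv x t by (simp add: inv_mult_group)
        then show ?thesis by (rule bexI[OF _ base(3)])
      qed
    next
      case (mult u v)
      then obtain f g where fg: "f \<in> F (Suc k)" "g \<in> F (Suc k)" "u = f t" "v = g t"
        using F[of "Suc k"] t by blast
      then have "(\<lambda>t. f t \<otimes> g t) \<in> E"
        unfolding E_def by force
      then show ?thesis
        by (rule rev_bexI) (simp add: fg mult(1))
    next
      case (conj i z)
      show ?thesis
      proof (cases "i \<le> M")
        case True
        have "k < Suc (k + i)" by simp
        from cover[OF this t conj(2)] obtain f where f: "f \<in> F (Suc (k + i))" "z = f t"
          by (rule bexE)
        then have "(\<lambda>t. inv (e i) \<otimes> f t \<otimes> e i) \<in> E"
          unfolding E_def using True by blast
        then show ?thesis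
          by (rule rev_bexI) (simp add: f conj(1))
      next
        case False
        then have "y = \<one>"
          using late[OF conj(2)] conj(1) ei by simp
        then show ?thesis by (rule bexI[OF _ base(1)])
      qed
    qed
    have "?ok k E"
      by (rule conjI[OF finE], rule conjI; intro ballI allI impI) (rule wordE coverE; assumption)+
    then show ?thesis by (rule exI)
  qed
qed

section \<open>Countable groups\<close>

text \<open>
  The invariant \<open>e k \<notin> U\<^sub>k\<^sub>+\<^sub>1\<close> (for \<open>e k \<noteq> \<one>\<close>), where \<open>U\<^sub>k\<^sub>+\<^sub>1\<close> is the set of
  elements at level \<open>k + 1\<close>, is what will make the limit topology Hausdorff. A choice \<open>t\<close> of the next
  element breaks it only if it solves one of finitely many equations \<open>f t = e k\<close>, none of which \<open>x\<close>
  solves, because \<open>x\<close> itself would add nothing to \<open>U\<^sub>k\<^sub>+\<^sub>1\<close>. As \<open>x\<close> is in the Zariski closure of \<open>A\<close>,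
  some element of \<open>A\<close> avoids all these equations.
\<close>

lemma extend_avoiding_enumeration:
  assumes S: "finite S" "S \<subseteq> {..<M} \<times> carrier G" and e: "range e \<subseteq> carrier G"
    and x: "x \<in> carrier G" and A: "A \<subseteq> carrier G"
    and closure: "\<And>F. finite F \<Longrightarrow> \<forall>B\<in>F. elementary_algebraic G B \<and> x \<notin> B \<Longrightarrow> \<not> A \<subseteq> \<Union>F"
    and avoid: "\<And>k. e k \<noteq> \<one> \<Longrightarrow> \<not> in_nbhd G e S (Suc k) (e k)"
  shows "\<exists>a\<in>A. \<forall>k. e k \<noteq> \<one> \<longrightarrow> \<not> in_nbhd G e (insert (M, inv x \<otimes> a) S) (Suc k) (e k)"
proof -
  let ?ok = "\<lambda>k F. finite F \<and> (\<forall>f\<in>F. word_function G f \<and> in_nbhd G e S (Suc k) (f x)) \<and>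
    (\<forall>t\<in>carrier G. \<forall>y. in_nbhd G e (insert (M, inv x \<otimes> t) S) (Suc k) y \<longrightarrow> (\<exists>f\<in>F. y = f t))"
  have "\<forall>k. \<exists>F. ?ok k F"
    using in_nbhd_insert_word_functions[OF S e x] by (intro allI)
  then obtain F where ok: "\<forall>k. ?ok k (F k)"
    by (rule choice[THEN exE])
  have F: "finite (F k)"
    "f \<in> F k \<Longrightarrow> word_function G f \<and> in_nbhd G e S (Suc k) (f x)"
    "t \<in> carrier G \<Longrightarrow> in_nbhd G e (insert (M, inv x \<otimes> t) S) (Suc k) y \<Longrightarrow> \<exists>f\<in>F k. y = f t" for k f t y
    using ok[rule_format, of k] by simp_all
  \<comment> \<open>Only \<open>k < M\<close> matters: otherwise level \<open>k + 1\<close> is beyond all indices and contains just the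
    identity.\<close>
  define Z where "Z = (\<Union>k\<in>{k. k < M \<and> e k \<noteq> \<one>}. (\<lambda>f. {t \<in> carrier G. f t = e k}) ` F k)"
  have finZ: "finite Z"
    unfolding Z_def using F(1) by auto
  have elemZ: "\<forall>B\<in>Z. elementary_algebraic G B \<and> x \<notin> B"
  proof
    fix B assume "B \<in> Z"
    then obtain k f where kf: "e k \<noteq> \<one>" "f \<in> F k" "B = {t \<in> carrier G. f t = e k}"
      unfolding Z_def by blast
    have "elementary_algebraic G B"
      using F(2)[OF kf(2)] e unfolding kf(3) by (intro elementary_algebraic_word_function_eq) auto
    moreover have "f x \<noteq> e k"
      using F(2)[OF kf(2)] avoid[OF kf(1)] by metis
    ultimately show "elementary_algebraic G B \<and> x \<notin> B"
      by (simp add: kf(3))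
  qed
  obtain a where a: "a \<in> A" "a \<notin> \<Union>Z"
    using closure[OF finZ elemZ] by (meson subsetI)
  have "\<not> in_nbhd G e (insert (M, inv x \<otimes> a) S) (Suc k) (e k)" if k: "e k \<noteq> \<one>" for k
  proof
    assume sm: "in_nbhd G e (insert (M, inv x \<otimes> a) S) (Suc k) (e k)"
    show False
    proof (cases "k < M")
      case True
      have "a \<in> carrier G"
        using a(1) A by blast
      from F(3)[OF this sm] obtain f where "f \<in> F k" "e k = f a"
        by (rule bexE)
      then have "a \<in> \<Union>Z"
        unfolding Z_def using True k a(1) A by fastforce
      with a(2) show False by blast
    next
      case False
      then show False
        using in_nbhd_beyond_indices[OF sm _ e] S(2) k by fastforce
    qed
  qed
  with a(1) show ?thesis by blast
qed

text \<open>
  Markov's theorem for countable groups. If \<open>x \<notin> A\<close> is in the Zariski closure of \<open>A\<close>, elements \<open>a\<close> of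
  \<open>A\<close> can be chosen one after the other so that the sequence of the \<open>inv x \<otimes> a\<close> tends to the identity
  in a Hausdorff group topology. Then \<open>x\<close> is a limit of points of \<open>A\<close>, which is therefore not closed.
\<close>

theorem countable_unconditionally_closed_imp_algebraic:
  assumes countable: "countable (carrier G)" and A: "A \<subseteq> carrier G" "unconditionally_closed G A"
  shows "algebraic_in G A"
proof (rule ccontr)
  assume "\<not> algebraic_in G A"
  then obtain x where x: "x \<in> carrier G - A"
    and closure: "\<And>F. finite F \<Longrightarrow> \<forall>B\<in>F. elementary_algebraic G B \<and> x \<notin> B \<Longrightarrow> \<not> A \<subseteq> \<Union>F"
    using algebraic_in_iff_separated[OF A(1)] by metis
  define e where "e = from_nat_into (carrier G)"
  have e: "range e = carrier G"
    unfolding e_def using countable by (intro range_from_nat_into) auto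
  let ?good = "\<lambda>M S. finite S \<and> S \<subseteq> {..<M} \<times> carrier G \<and>
    (\<forall>k. e k \<noteq> \<one> \<longrightarrow> \<not> in_nbhd G e S (Suc k) (e k))"
  have "\<exists>S. \<forall>M. ?good M (S M) \<and> (\<exists>a\<in>A. S (Suc M) = insert (M, inv x \<otimes> a) (S M))"
  proof (rule dependent_nat_choice)
    have "?good 0 {}"
      using in_nbhd_beyond_indices[of e "{}"] e by auto
    then show "\<exists>S. ?good 0 S" by blast
  next
    fix S M assume S: "?good M S"
    obtain a where a: "a \<in> A"
      "\<forall>k. e k \<noteq> \<one> \<longrightarrow> \<not> in_nbhd G e (insert (M, inv x \<otimes> a) S) (Suc k) (e k)"
      using extend_avoiding_enumeration[of S M e x A] S e x A(1) closure by blast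
    have "inv x \<otimes> a \<in> carrier G"
      using a(1) A(1) x by blast
    then have "?good (Suc M) (insert (M, inv x \<otimes> a) S)"
      using S a(2) by (auto simp: less_Suc_eq)
    with a(1) show "\<exists>S'. ?good (Suc M) S' \<and> (\<exists>a\<in>A. S' = insert (M, inv x \<otimes> a) S)"
      by blast
  qed
  then obtain S where good: "\<And>M. ?good M (S M)"
    and step: "\<And>M. \<exists>a\<in>A. S (Suc M) = insert (M, inv x \<otimes> a) (S M)"
    by metis
  have mono: "S m \<subseteq> S n" if "m \<le> n" for m n
    using that by (rule lift_Suc_mono_le[rotated]) (use step in blast)
  define T where "T = (\<Union>M. S M)"
  have T: "T \<subseteq> UNIV \<times> carrier G"
    unfolding T_def using good by blast
  have e': "range e \<subseteq> carrier G" using e by simp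
  have avoid: "\<not> in_nbhd G e T (Suc k) (e k)" if "e k \<noteq> \<one>" for k
    using in_nbhd_directed_Union[of G e S, OF _ mono] good that unfolding T_def by blast
  interpret base: identity_neighbourhood_base G "range (\<lambda>k. {y. in_nbhd G e T k y})"
  proof
    show "\<exists>W\<in>range (\<lambda>k. {y. in_nbhd G e T k y}). W \<subseteq> U \<inter> V"
      if UV: "U \<in> range (\<lambda>k. {y. in_nbhd G e T k y})" "V \<in> range (\<lambda>k. {y. in_nbhd G e T k y})" for U V
    proof -
      obtain k l where "U = {y. in_nbhd G e T k y}" "V = {y. in_nbhd G e T l y}"
        using UV by blast
      then have "{y. in_nbhd G e T (max k l) y} \<subseteq> U \<inter> V"
        using in_nbhd_antimono[OF _ _ e' T] max.cobounded1 max.cobounded2 by blast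
      then show ?thesis by blast
    qed
    show "\<exists>V\<in>range (\<lambda>k. {y. in_nbhd G e T k y}). \<forall>y\<in>V. inv g \<otimes> y \<otimes> g \<in> U"
      if U: "U \<in> range (\<lambda>k. {y. in_nbhd G e T k y})" and g: "g \<in> carrier G" for U g
    proof -
      obtain k i where "U = {y. in_nbhd G e T k y}" "g = e i"
        using U g e by blast
      then have "\<forall>y\<in>{y. in_nbhd G e T (Suc (k + i)) y}. inv g \<otimes> y \<otimes> g \<in> U"
        by (auto intro: in_nbhd.conj)
      then show ?thesis by blast
    qed
    show "\<exists>U\<in>range (\<lambda>k. {y. in_nbhd G e T k y}). g \<notin> U" if g: "g \<in> carrier G" "g \<noteq> \<one>" for g
    proof -
      obtain k where "g = e k" using g e by blast
      with avoid g have "g \<notin> {y. in_nbhd G e T (Suc k) y}" by blast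
      then show ?thesis by blast
    qed
    show "\<exists>V\<in>range (\<lambda>k. {y. in_nbhd G e T k y}). \<forall>y\<in>V. \<forall>z\<in>V. y \<otimes> z \<in> U"
      if "U \<in> range (\<lambda>k. {y. in_nbhd G e T k y})" for U
      using that by (auto intro: in_nbhd.mult)
    show "\<exists>V\<in>range (\<lambda>k. {y. in_nbhd G e T k y}). \<forall>y\<in>V. inv y \<in> U"
      if "U \<in> range (\<lambda>k. {y. in_nbhd G e T k y})" for U
      using that in_nbhd_inv[OF _ e' T] by auto
  qed (use in_nbhd_closed[OF _ e' T] in_nbhd.one in auto)
  obtain k where k: "\<forall>u\<in>{y. in_nbhd G e T k y}. x \<otimes> u \<notin> A"
    using base.unconditionally_closed_avoids_translate[OF A(2) x] by blast
  obtain a where a: "a \<in> A" "S (Suc k) = insert (k, inv x \<otimes> a) (S k)"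
    using step by blast
  then have "(k, inv x \<otimes> a) \<in> T"
    unfolding T_def by blast
  then have "in_nbhd G e T k (inv x \<otimes> a)"
    by (rule in_nbhd.gen) simp
  moreover have "x \<otimes> (inv x \<otimes> a) = a"
    using x a(1) A(1) by (auto simp: m_assoc[symmetric])
  ultimately show False
    using k a(1) by force
qed

end

section \<open>Subgroups of direct products\<close>

lemma eval_word_subgroup:
  assumes "group G" "subgroup N G" "\<forall>l\<in>set w. constants l \<subseteq> N" "x \<in> N"
  shows "eval_word (G\<lparr>carrier := N\<rparr>) w x = eval_word G w x"
  using assms(3)
proof (induction w)
  case (Cons l w)
  have "eval_letter (G\<lparr>carrier := N\<rparr>) x l = eval_letter G x l"
    using assms by (cases l) (auto simp: group.m_inv_consistent)
  with Cons show ?case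
    by (simp add: eval_word_def)
qed (simp add: eval_word_def)

lemma elementary_algebraic_subgroup_word:
  assumes "group G" "subgroup N G" "elementary_algebraic (G\<lparr>carrier := N\<rparr>) B"
  shows "\<exists>w. (\<forall>l\<in>set w. constants l \<subseteq> N) \<and> B = {x \<in> N. eval_word G w x = \<one>\<^bsub>G\<^esub>}"
proof -
  obtain w where w: "\<forall>l\<in>set w. constants l \<subseteq> N"
    "B = {x \<in> N. eval_word (G\<lparr>carrier := N\<rparr>) w x = \<one>\<^bsub>G\<^esub>}"
    using assms(3) by (auto simp: elementary_algebraic_def)
  then show ?thesis
    using eval_word_subgroup[OF assms(1,2) w(1)] by (intro exI[of _ w]) auto
qed

lemma countable_words: "countable C \<Longrightarrow> countable {w. \<forall>l\<in>set w. constants l \<subseteq> C}"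
proof -
  assume "countable C"
  have "{l. constants l \<subseteq> C} \<subseteq> Const ` C \<union> {Var, VarInv}"
  proof
    fix l assume "l \<in> {l. constants l \<subseteq> C}"
    then show "l \<in> Const ` C \<union> {Var, VarInv}" by (cases l) auto
  qed
  then have "countable {l. constants l \<subseteq> C}"
    by (rule countable_subset) (use \<open>countable C\<close> in simp)
  moreover have "{w. \<forall>l\<in>set w. constants l \<subseteq> C} = lists {l. constants l \<subseteq> C}"
    by (auto simp: lists_eq_set)
  ultimately show ?thesis by simp
qed

text \<open>
  A finitary closure condition with countable increments is met by a countable set: iterate it \<open>\<omega>\<close>
  times, and note that a finite subset of the union already lies in one of the stages.
\<close>

lemma countable_closed_superset:
  assumes step: "\<And>F. finite F \<Longrightarrow> F \<subseteq> I \<Longrightarrow> countable (f F) \<and> f F \<subseteq> I"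
    and J0: "countable J0" "J0 \<subseteq> I"
  obtains J where "countable J" "J0 \<subseteq> J" "J \<subseteq> I" "\<And>F. finite F \<Longrightarrow> F \<subseteq> J \<Longrightarrow> f F \<subseteq> J"
proof
  define J where "J = rec_nat J0 (\<lambda>_ K. K \<union> (\<Union>F\<in>{F. finite F \<and> F \<subseteq> K}. f F))"
  have J_simps: "J 0 = J0" "J (Suc n) = J n \<union> (\<Union>F\<in>{F. finite F \<and> F \<subseteq> J n}. f F)" for n
    by (simp_all add: J_def)
  have sub: "J n \<subseteq> I" for n
  proof (induction n)
    case (Suc n)
    then have "f F \<subseteq> I" if "finite F" "F \<subseteq> J n" for F
      using step[of F] that by blast
    with Suc show ?case unfolding J_simps(2) by blast
  qed (simp add: J_simps J0)
  have "countable (J n)" for n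
  proof (induction n)
    case (Suc n)
    have "countable (f F)" if "finite F" "F \<subseteq> J n" for F
      using step[of F] that sub[of n] by blast
    with Suc show ?case
      unfolding J_simps(2) by (auto intro: countable_Collect_finite_subset)
  qed (simp add: J_simps J0)
  then show "countable (\<Union>n. J n)" by simp
  show "J0 \<subseteq> (\<Union>n. J n)" using J_simps(1) by blast
  show "(\<Union>n. J n) \<subseteq> I" using sub by blast
  have mono: "J m \<subseteq> J n" if "m \<le> n" for m n
    using that by (rule lift_Suc_mono_le[rotated]) (use J_simps in blast)
  show "f F \<subseteq> (\<Union>n. J n)" if F: "finite F" "F \<subseteq> (\<Union>n. J n)" for F
  proof -
    have "\<exists>n. F \<subseteq> J n"
      using F
    proof (induction F)
      case (insert i F)
      then obtain m n where "F \<subseteq> J m" "i \<in> J n" by blast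
      then have "insert i F \<subseteq> J (max m n)"
        using mono[of m "max m n"] mono[of n "max m n"] by auto
      then show ?case by blast
    qed simp
    then obtain n where "F \<subseteq> J n" by blast
    then have "f F \<subseteq> J (Suc n)" using F(1) unfolding J_simps(2) by blast
    then show ?thesis by blast
  qed
qed

definition subproduct :: "'i set \<Rightarrow> ('i \<Rightarrow> ('a, 'b) monoid_scheme) \<Rightarrow> 'i set \<Rightarrow> ('i \<Rightarrow> 'a) set"
  where "subproduct I G J =
    carrier (sum_group I G) \<inter> (\<Pi>\<^sub>E i\<in>I. if i \<in> J then carrier (G i) else {\<one>\<^bsub>G i\<^esub>})"

lemma in_subproduct_iff:
  assumes "\<And>i. i \<in> I \<Longrightarrow> group (G i)" "f \<in> carrier (sum_group I G)"
  shows "f \<in> subproduct I G J \<longleftrightarrow> {i \<in> I. f i \<noteq> \<one>\<^bsub>G i\<^esub>} \<subseteq> J"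
  using assms by (auto simp: subproduct_def carrier_sum_group PiE_iff split: if_splits)

lemma countable_carrier_subproduct:
  assumes G: "\<And>i. i \<in> I \<Longrightarrow> group (G i)" "\<And>i. i \<in> I \<Longrightarrow> countable (carrier (G i))"
    and J: "countable J" "J \<subseteq> I"
  shows "countable (subproduct I G J)"
proof -
  \<comment> \<open>An element is determined by its values on its finite support.\<close>
  let ?graph = "\<lambda>f. (\<lambda>i. (i, f i)) ` {i \<in> I. f i \<noteq> \<one>\<^bsub>G i\<^esub>}"
  have sub: "f \<in> carrier (sum_group I G) \<and> {i \<in> I. f i \<noteq> \<one>\<^bsub>G i\<^esub>} \<subseteq> J" if "f \<in> subproduct I G J" for f
    using that in_subproduct_iff[of I G f J, OF G(1)] by (auto simp: subproduct_def)
  have "inj_on ?graph (subproduct I G J)"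
  proof (rule inj_onI)
    fix f g assume f: "f \<in> subproduct I G J" and g: "g \<in> subproduct I G J" and eq: "?graph f = ?graph g"
    have "f i = g i" if "i \<in> I" for i
    proof (cases "f i = \<one>\<^bsub>G i\<^esub> \<and> g i = \<one>\<^bsub>G i\<^esub>")
      case False
      then have "(i, f i) \<in> ?graph f \<or> (i, g i) \<in> ?graph g" using that by blast
      then have "(i, f i) \<in> ?graph g \<or> (i, g i) \<in> ?graph f" using eq by blast
      then show ?thesis by auto
    qed simp
    then show "f = g"
      using f g by (auto simp: subproduct_def intro: PiE_ext)
  qed
  moreover have "?graph ` subproduct I G J \<subseteq> {F. finite F \<and> F \<subseteq> (SIGMA i:J. carrier (G i))}"
  proof
    fix F assume "F \<in> ?graph ` subproduct I G J"
    then obtain f where f: "f \<in> subproduct I G J" "F = ?graph f" by blast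
    then show "F \<in> {F. finite F \<and> F \<subseteq> (SIGMA i:J. carrier (G i))}"
      using sub[OF f(1)] G(1) by (auto simp: carrier_sum_group PiE_iff)
  qed
  moreover have "countable {F. finite F \<and> F \<subseteq> (SIGMA i:J. carrier (G i))}"
    using J G(2) by (intro countable_Collect_finite_subset countable_SIGMA) auto
  ultimately show ?thesis
    by (meson countable_image_inj_on countable_subset)
qed

theorem theorem1:
  fixes I :: "'i set" and G :: "'i \<Rightarrow> ('a, 'b) monoid_scheme"
    and H A :: "('i \<Rightarrow> 'a) set"
  assumes "\<And>i. i \<in> I \<Longrightarrow> group (G i)"
    and "\<And>i. i \<in> I \<Longrightarrow> countable (carrier (G i))"
    and "subgroup H (sum_group I G)"
    and "\<And>K. countable_subproduct I G K \<Longrightarrow>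
          supernormal (H \<inter> K) ((sum_group I G)\<lparr>carrier := H\<rparr>)"
    and "A \<subseteq> H"
  shows "unconditionally_closed ((sum_group I G)\<lparr>carrier := H\<rparr>) A \<longleftrightarrow>
         algebraic_in ((sum_group I G)\<lparr>carrier := H\<rparr>) A"
proof
  let ?P = "(sum_group I G)\<lparr>carrier := H\<rparr>"
  have group: "group ?P"
    using assms(1,3) by (simp add: subgroup.subgroup_is_group)
  then show "unconditionally_closed ?P A" if "algebraic_in ?P A"
    using that by (rule algebraic_imp_unconditionally_closed)
  assume uc: "unconditionally_closed ?P A"
  show "algebraic_in ?P A"
  proof (rule ccontr)
    assume "\<not> algebraic_in ?P A"
    moreover have "A \<subseteq> carrier ?P"
      using assms(5) by simp
    ultimately obtain x where x: "x \<in> carrier ?P - A"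
      and closure: "\<And>F. finite F \<Longrightarrow> \<forall>B\<in>F. elementary_algebraic ?P B \<and> x \<notin> B \<Longrightarrow> \<not> A \<subseteq> \<Union>F"
      using algebraic_in_iff_separated[of A ?P] by metis
    have xH: "x \<in> H"
      using x by simp
    \<comment> \<open>Every finite set of words that \<open>x\<close> does not solve has a witness in \<open>A\<close> that solves none of them.
      The supports of the witnesses for words over the subproduct of \<open>J\<close> form \<open>wit J\<close>.\<close>
    define supp where "supp = (\<lambda>f. {i \<in> I. f i \<noteq> \<one>\<^bsub>G i\<^esub>})"
    have H_sub: "H \<subseteq> carrier (sum_group I G)"
      using assms(3) by (rule subgroup.subset)
    have supp: "finite (supp f)" "supp f \<subseteq> I" if "f \<in> H" for f
      using that H_sub assms(1) by (auto simp: supp_def carrier_sum_group)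
    have in_sub: "f \<in> H \<inter> subproduct I G J \<longleftrightarrow> supp f \<subseteq> J" if "f \<in> H" for f J
      using that H_sub in_subproduct_iff[of I G f J, OF assms(1)] by (auto simp: supp_def)
    define words where "words = (\<lambda>J. {w. \<forall>l\<in>set w. constants l \<subseteq> H \<inter> subproduct I G J})"
    define unsolved where "unsolved = (\<lambda>W a. \<forall>w\<in>W. eval_word ?P w a \<noteq> \<one>\<^bsub>?P\<^esub>)"
    have "\<exists>a\<in>A. unsolved W a"
      if W: "finite W" "\<forall>w\<in>W. \<forall>l\<in>set w. constants l \<subseteq> H" "unsolved W x" for W
    proof -
      let ?F = "(\<lambda>w. {y \<in> carrier ?P. eval_word ?P w y = \<one>\<^bsub>?P\<^esub>}) ` W"
      have "\<forall>B\<in>?F. elementary_algebraic ?P B \<and> x \<notin> B"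
        using W(2,3) unfolding elementary_algebraic_def unsolved_def by auto
      then have "\<not> A \<subseteq> \<Union>?F"
        using closure[of ?F] W(1) by blast
      then show ?thesis
        using assms(5) by (auto simp: unsolved_def)
    qed
    then obtain s where s: "\<And>W. finite W \<Longrightarrow> \<forall>w\<in>W. \<forall>l\<in>set w. constants l \<subseteq> H \<Longrightarrow> unsolved W x
        \<Longrightarrow> s W \<in> A \<and> unsolved W (s W)"
      by metis
    define wit where "wit = (\<lambda>J. \<Union>W\<in>{W. finite W \<and> W \<subseteq> words J \<and> unsolved W x}. supp (s W))"
    have s_words: "s W \<in> A \<and> unsolved W (s W)"
      if "finite W" "W \<subseteq> words J" "unsolved W x" for W J
      using that by (intro s) (auto simp: words_def)
    have s_supp: "finite (supp (s W)) \<and> supp (s W) \<subseteq> I"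
      if "finite W" "W \<subseteq> words J" "unsolved W x" for W J
      using s_words[OF that] supp[of "s W"] assms(5) by auto
    have "countable (wit F) \<and> wit F \<subseteq> I" if F: "finite F" "F \<subseteq> I" for F
    proof
      have "countable (H \<inter> subproduct I G F)"
        using countable_carrier_subproduct[of I G F, OF assms(1,2)] F by (simp add: countable_finite)
      then have "countable {W. finite W \<and> W \<subseteq> words F}"
        unfolding words_def by (intro countable_Collect_finite_subset countable_words)
      then have "countable {W. finite W \<and> W \<subseteq> words F \<and> unsolved W x}"
        by (rule countable_subset[rotated]) auto
      then show "countable (wit F)"
        unfolding wit_def by (rule countable_UN) (use s_supp in \<open>auto intro: countable_finite\<close>)
      show "wit F \<subseteq> I"
        unfolding wit_def using s_supp by (intro UN_least) auto
    qed
    \<comment> \<open>\<open>J\<close> is large enough that words over its subproduct have their witnesses in that subproduct.\<close>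
    then obtain J where J: "countable J" "supp x \<subseteq> J" "J \<subseteq> I"
      and J_closed: "\<And>F. finite F \<Longrightarrow> F \<subseteq> J \<Longrightarrow> wit F \<subseteq> J"
      using countable_closed_superset[of I wit "supp x"] supp[OF xH] by (metis countable_finite)
    define N where "N = H \<inter> subproduct I G J"
    have N: "supernormal N ?P"
      unfolding N_def using J
      by (intro assms(4)) (auto simp: countable_subproduct_def subproduct_def)
    then have sub: "subgroup N ?P"
      by (simp add: supernormal_def)
    then have groupN: "group (?P\<lparr>carrier := N\<rparr>)"
      using group by (rule subgroup.subgroup_is_group)
    have countN: "countable (carrier (?P\<lparr>carrier := N\<rparr>))"
      unfolding N_def using countable_carrier_subproduct[of I G J, OF assms(1,2) J(1,3)] by simp
    have "unconditionally_closed (?P\<lparr>carrier := N\<rparr>) (A \<inter> N)"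
      using unconditionally_closed_Int_supernormal[OF group N _ uc] assms(5) by simp
    then have algN: "algebraic_in (?P\<lparr>carrier := N\<rparr>) (A \<inter> N)"
      using group.countable_unconditionally_closed_imp_algebraic[OF groupN countN] by simp
    have xNA: "x \<in> N - A \<inter> N"
      using x xH in_sub[of x J] J(2) unfolding N_def by blast
    have "\<exists>F. finite F \<and> (\<forall>B\<in>F. elementary_algebraic (?P\<lparr>carrier := N\<rparr>) B \<and> x \<notin> B) \<and> A \<inter> N \<subseteq> \<Union>F"
      by (rule algebraic_in_iff_separated[THEN iffD1, OF _ algN, rule_format]) (use xNA in auto)
    then obtain F where F: "finite F" "A \<inter> N \<subseteq> \<Union>F"
      "\<forall>B\<in>F. elementary_algebraic (?P\<lparr>carrier := N\<rparr>) B \<and> x \<notin> B"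
      by (elim exE conjE)
    have xN: "x \<in> N"
      using xNA by blast
    have "\<forall>B\<in>F. \<exists>w. (\<forall>l\<in>set w. constants l \<subseteq> N) \<and> B = {y \<in> N. eval_word ?P w y = \<one>\<^bsub>?P\<^esub>}"
      using F(3) by (intro ballI elementary_algebraic_subgroup_word[OF group sub]) blast
    then obtain wd where
      wd: "\<forall>B\<in>F. (\<forall>l\<in>set (wd B). constants l \<subseteq> N) \<and> B = {y \<in> N. eval_word ?P (wd B) y = \<one>\<^bsub>?P\<^esub>}"
      by (rule bchoice[THEN exE])
    have wd_solves: "y \<in> B \<longleftrightarrow> y \<in> N \<and> eval_word ?P (wd B) y = \<one>\<^bsub>?P\<^esub>" if "B \<in> F" for B y
      using set_eq_iff[THEN iffD1, OF conjunct2[OF bspec[OF wd that]], rule_format, of y] by simp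
    define W where "W = wd ` F"
    \<comment> \<open>Finitely many words have finitely many constants, all supported on a finite \<open>E \<subseteq> J\<close>, so the
      closure property of \<open>J\<close> applies to them.\<close>
    define C where "C = (\<Union>w\<in>W. \<Union>l\<in>set w. constants l)"
    have C: "finite C" "C \<subseteq> N"
    proof -
      have "finite (constants l)" for l :: "('i \<Rightarrow> 'a) letter"
        by (cases l) auto
      then show "finite C"
        unfolding C_def W_def using F(1) by auto
      show "C \<subseteq> N"
        unfolding C_def W_def using wd by blast
    qed
    define E where "E = (\<Union>c\<in>C. supp c)"
    have C_supp: "c \<in> H" "supp c \<subseteq> J" if "c \<in> C" for c
      using that C(2) in_sub[of c J] unfolding N_def by auto
    have E: "finite E" "E \<subseteq> J"
      unfolding E_def using C(1) C_supp supp(1) by auto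
    have "C \<subseteq> H \<inter> subproduct I G E"
      using C_supp(1) in_sub[of _ E] unfolding E_def by blast
    then have W: "finite W" "W \<subseteq> words E"
      unfolding words_def C_def using F(1) by (auto simp: W_def)
    have unsolved_x: "unsolved W x"
      unfolding unsolved_def W_def using wd_solves F(3) xN by blast
    have sW: "s W \<in> A" "unsolved W (s W)"
      using s_words[OF W unsolved_x] by auto
    have "supp (s W) \<subseteq> J"
      using J_closed[OF E] W unsolved_x unfolding wit_def by blast
    then have "s W \<in> N"
      unfolding N_def using in_sub[of "s W" J] sW(1) assms(5) by blast
    with F(2) sW(1) obtain B where "B \<in> F" "s W \<in> B" by blast
    then have "eval_word ?P (wd B) (s W) = \<one>\<^bsub>?P\<^esub>"
      using wd_solves by blast
    with sW(2) \<open>B \<in> F\<close> show False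
      unfolding unsolved_def W_def by blast
  qed
qed

end
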